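(* Let $\varepsilon>0$ and let $[u,v_1,v_2,v_3,w]^T\in\mathbb{R}^5$ with $[u,v_1,v_2,v_3,w]^T\notin G^\varepsilon_3$. (i) Suppose $v_3\neq0$ or $v_1=v_2=v_3=0$. If $v_3\ne0$, put $a=1+v_1^2/v_3^2+v_2^2/v_3^2$. Let $C\subset\mathbb{R}^5$ be the set consisting exactly of the following points $[\rho,m_1,m_2,m_3,E]^T$: 1. $[\varepsilon,v_1,v_2,v_3,w]^T$, if $\varepsilon>u$ and $\varepsilon-w+\frac{v_1^2+v_2^2+v_3^2}{2\varepsilon}\le0$. 2. $[\varepsilon,0,0,0,\varepsilon]^T$, if $v_1=v_2=v_3=0$, $\varepsilon>u$ and $\varepsilon>w$. 3. If $v_3\ne0$: for each real root $m_3$ of the cubic equation $a m_3^3+(4\varepsilon^2-2\varepsilon w)m_3-2\varepsilon^2v_3=0$, the point $\big[\varepsilon,\frac{v_1}{v_3}m_3,\frac{v_2}{v_3}m_3,m_3,\frac{a}{2\varepsilon}m_3^2+\varepsilon\big]^T$, provided $\varepsilon\big(\frac{v_3}{m_3}-1\big)>0$ and $\varepsilon-u-\frac{a}{2\varepsilon}m_3(v_3-m_3)>0$. 4. $[u,0,0,0,\varepsilon]^T$, if $v_1=v_2=v_3=0$, $\varepsilon>w$ and $\varepsilon\le u$. 5. If $v_3\ne0$: for each of the two values $$\rho=\frac u2\pm\frac12\,\frac{\sqrt{u^2\big(2v_3^2+\frac1a(\varepsilon+u-w)^2\big)-2uv_3^2(w-\varepsilon)+a v_3^4}}{\sqrt{2v_3^2+\frac1a(\varepsilon+u-w)^2}}$$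 that is real, and each of the two values $$m_3=\frac{v_3}{2}\pm\frac{1}{2a}\sqrt{-8a\rho^2+8au\rho+a^2v_3^2}$$ that is real, the point $\big[\rho,\frac{v_1}{v_3}m_3,\frac{v_2}{v_3}m_3,m_3,\varepsilon+a\frac{m_3^2}{2\rho}\big]^T$, provided $\rho\ge\varepsilon$ and $\varepsilon+a\frac{m_3^2}{2\rho}-w>0$. Then there is a point of $C$ minimizing $\frac12\big(|\rho-u|^2+|m_1-v_1|^2+|m_2-v_2|^2+|m_3-v_3|^2+|E-w|^2\big)$ over $C$, and such a point is the Euclidean projection of $[u,v_1,v_2,v_3,w]^T$ onto $G^\varepsilon_3$. (ii) If $v_3=0$ and $v_1,v_2$ are not both zero, then the Euclidean projection of $[u,v_1,v_2,0,w]^T$ onto $G^\varepsilon_3$ is $[\rho,m_1,m_2,0,E]^T$, where $[\rho,m_1,m_2,E]^T$ is the Euclidean projection of $[u,v_1,v_2,w]^T$ onto $G^\varepsilon_2$.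
   Context: For $d\in\{2,3\}$ let $G^\varepsilon_d=\{[\rho,m_1,\dots,m_d,E]^T\in\mathbb{R}^{d+2}:\ \rho\ge\varepsilon,\ E-\frac{m_1^2+\cdots+m_d^2}{2\rho}\ge\varepsilon\}$, a closed convex set. The Euclidean projection of a point onto $G^\varepsilon_d$ is the unique point of $G^\varepsilon_d$ at minimal Euclidean distance from it. *)

theory Defs
  imports "HOL-Analysis.Analysis"
begin

text \<open>
  A point \<open>[\<rho>, m\<^sub>1, \<dots>, m\<^sub>d, E]\<^sup>T\<close> of \<open>\<real>\<^bsup>d+2\<^esup>\<close> is a vector of type \<open>real ^ 4\<close> (\<open>d = 2\<close>)
  or \<open>real ^ 5\<close> (\<open>d = 3\<close>) with components \<open>1, \<dots>, d+2\<close> in this order.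
\<close>

definition G2 :: "real \<Rightarrow> (real ^ 4) set" where
  "G2 \<epsilon> = {x. x$1 \<ge> \<epsilon> \<and> x$4 - ((x$2)^2 + (x$3)^2) / (2 * x$1) \<ge> \<epsilon>}"

definition G3 :: "real \<Rightarrow> (real ^ 5) set" where
  "G3 \<epsilon> = {x. x$1 \<ge> \<epsilon> \<and> x$5 - ((x$2)^2 + (x$3)^2 + (x$4)^2) / (2 * x$1) \<ge> \<epsilon>}"

definition coeff_a :: "real \<Rightarrow> real \<Rightarrow> real \<Rightarrow> real" where
  "coeff_a v1 v2 v3 = 1 + v1^2 / v3^2 + v2^2 / v3^2"

text \<open>
  In the next two definitions the conditions \<open>\<dots> \<ge> 0\<close> say that the value is real: \<open>sqrt\<close> is total
  on the reals. The radicand in the denominator of \<open>rho_values\<close> is positive whenever \<open>v\<^sub>3 \<noteq> 0\<close>.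
\<close>

definition rho_values :: "real \<Rightarrow> real \<Rightarrow> real \<Rightarrow> real \<Rightarrow> real \<Rightarrow> real \<Rightarrow> real set" where
  "rho_values \<epsilon> u v1 v2 v3 w =
     (let a = coeff_a v1 v2 v3;
          den = 2 * v3^2 + 1 / a * (\<epsilon> + u - w)^2;
          num = u^2 * den - 2 * u * v3^2 * (w - \<epsilon>) + a * v3^4
      in {\<rho>. num \<ge> 0 \<and>
             (\<rho> = u / 2 + 1 / 2 * (sqrt num / sqrt den) \<or>
              \<rho> = u / 2 - 1 / 2 * (sqrt num / sqrt den))})"

definition m3_values :: "real \<Rightarrow> real \<Rightarrow> real \<Rightarrow> real \<Rightarrow> real \<Rightarrow> real set" where
  "m3_values u v1 v2 v3 \<rho> =
     (let a = coeff_a v1 v2 v3;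
          disc = - 8 * a * \<rho>^2 + 8 * a * u * \<rho> + a^2 * v3^2
      in {m3. disc \<ge> 0 \<and>
              (m3 = v3 / 2 + 1 / (2 * a) * sqrt disc \<or>
               m3 = v3 / 2 - 1 / (2 * a) * sqrt disc)})"

definition cand1 :: "real \<Rightarrow> real \<Rightarrow> real \<Rightarrow> real \<Rightarrow> real \<Rightarrow> real \<Rightarrow> (real ^ 5) set" where
  "cand1 \<epsilon> u v1 v2 v3 w =
     {p. p = vector [\<epsilon>, v1, v2, v3, w] \<and>
         \<epsilon> > u \<and> \<epsilon> - w + (v1^2 + v2^2 + v3^2) / (2 * \<epsilon>) \<le> 0}"

definition cand2 :: "real \<Rightarrow> real \<Rightarrow> real \<Rightarrow> real \<Rightarrow> real \<Rightarrow> real \<Rightarrow> (real ^ 5) set" where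
  "cand2 \<epsilon> u v1 v2 v3 w =
     {p. p = vector [\<epsilon>, 0, 0, 0, \<epsilon>] \<and>
         v1 = 0 \<and> v2 = 0 \<and> v3 = 0 \<and> \<epsilon> > u \<and> \<epsilon> > w}"

definition cand3 :: "real \<Rightarrow> real \<Rightarrow> real \<Rightarrow> real \<Rightarrow> real \<Rightarrow> real \<Rightarrow> (real ^ 5) set" where
  "cand3 \<epsilon> u v1 v2 v3 w =
     (let a = coeff_a v1 v2 v3
      in {vector [\<epsilon>, v1 / v3 * m3, v2 / v3 * m3, m3, a / (2 * \<epsilon>) * m3^2 + \<epsilon>] | m3.
           v3 \<noteq> 0 \<and>
           a * m3^3 + (4 * \<epsilon>^2 - 2 * \<epsilon> * w) * m3 - 2 * \<epsilon>^2 * v3 = 0 \<and>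
           \<epsilon> * (v3 / m3 - 1) > 0 \<and>
           \<epsilon> - u - a / (2 * \<epsilon>) * m3 * (v3 - m3) > 0})"

definition cand4 :: "real \<Rightarrow> real \<Rightarrow> real \<Rightarrow> real \<Rightarrow> real \<Rightarrow> real \<Rightarrow> (real ^ 5) set" where
  "cand4 \<epsilon> u v1 v2 v3 w =
     {p. p = vector [u, 0, 0, 0, \<epsilon>] \<and>
         v1 = 0 \<and> v2 = 0 \<and> v3 = 0 \<and> \<epsilon> > w \<and> \<epsilon> \<le> u}"

definition cand5 :: "real \<Rightarrow> real \<Rightarrow> real \<Rightarrow> real \<Rightarrow> real \<Rightarrow> real \<Rightarrow> (real ^ 5) set" where
  "cand5 \<epsilon> u v1 v2 v3 w =
     (let a = coeff_a v1 v2 v3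
      in {vector [\<rho>, v1 / v3 * m3, v2 / v3 * m3, m3, \<epsilon> + a * (m3^2 / (2 * \<rho>))] | \<rho> m3.
           v3 \<noteq> 0 \<and>
           \<rho> \<in> rho_values \<epsilon> u v1 v2 v3 w \<and>
           m3 \<in> m3_values u v1 v2 v3 \<rho> \<and>
           \<rho> \<ge> \<epsilon> \<and>
           \<epsilon> + a * (m3^2 / (2 * \<rho>)) - w > 0})"

definition candidates :: "real \<Rightarrow> real \<Rightarrow> real \<Rightarrow> real \<Rightarrow> real \<Rightarrow> real \<Rightarrow> (real ^ 5) set" where
  "candidates \<epsilon> u v1 v2 v3 w =
     cand1 \<epsilon> u v1 v2 v3 w \<union> cand2 \<epsilon> u v1 v2 v3 w \<union> cand3 \<epsilon> u v1 v2 v3 w \<union>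
     cand4 \<epsilon> u v1 v2 v3 w \<union> cand5 \<epsilon> u v1 v2 v3 w"

definition objective :: "real \<Rightarrow> real \<Rightarrow> real \<Rightarrow> real \<Rightarrow> real \<Rightarrow> real ^ 5 \<Rightarrow> real" where
  "objective u v1 v2 v3 w p =
     1 / 2 * (\<bar>p$1 - u\<bar>^2 + \<bar>p$2 - v1\<bar>^2 + \<bar>p$3 - v2\<bar>^2 + \<bar>p$4 - v3\<bar>^2 + \<bar>p$5 - w\<bar>^2)"

text \<open>
  \<open>closest_point S x\<close> is chosen by the choice operator. The following facts show that for
  \<open>S = G2 \<epsilon>\<close> and \<open>S = G3 \<epsilon>\<close> with \<open>\<epsilon> > 0\<close> it is the unique nearest point of \<open>S\<close>.
\<close>

lemma quad_over_lin:
  fixes p q s t x y :: real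
  assumes "p > 0" "q > 0" "s \<ge> 0" "t \<ge> 0" "s + t = 1"
  shows "(s * x + t * y)^2 / (2 * (s * p + t * q)) \<le> s * (x^2 / (2 * p)) + t * (y^2 / (2 * q))"
proof -
  have pos: "s * p + t * q > 0"
    using assms by (cases "s = 0") (auto intro: add_pos_nonneg)
  have "(s * (x^2 / p) + t * (y^2 / q)) * (s * p + t * q) - (s * x + t * y)^2
        = s * t * (x * q - y * p)^2 / (p * q)"
    using assms by (simp add: field_simps power2_eq_square)
  moreover have "\<dots> \<ge> 0" using assms by simp
  ultimately have "(s * x + t * y)^2 \<le> (s * (x^2 / p) + t * (y^2 / q)) * (s * p + t * q)"
    by linarith
  then have "(s * x + t * y)^2 / (s * p + t * q) \<le> s * (x^2 / p) + t * (y^2 / q)"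
    using pos by (simp add: pos_divide_le_eq)
  moreover have "c / (2 * d) = c / d / 2" "r * (c / (2 * d)) = r * (c / d) / 2" for c d r :: real
    by simp_all
  ultimately show ?thesis by (metis add_divide_distrib divide_right_mono zero_le_numeral)
qed

lemma convex_G2: assumes "\<epsilon> > 0" shows "convex (G2 \<epsilon>)"
proof (rule convexI)
  fix x y :: "real ^ 4" and s t :: real
  assume x: "x \<in> G2 \<epsilon>" and y: "y \<in> G2 \<epsilon>" and st: "0 \<le> s" "0 \<le> t" "s + t = 1"
  have px: "x$1 > 0" and py: "y$1 > 0" using x y assms by (auto simp: G2_def)
  note q = quad_over_lin[OF px py st]
  have "s * \<epsilon> + t * \<epsilon> \<le> s * x$1 + t * y$1"
    using x y st by (intro add_mono mult_left_mono) (auto simp: G2_def)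
  moreover have "s * \<epsilon> + t * \<epsilon> \<le> s * (x$4 - ((x$2)^2 + (x$3)^2) / (2 * x$1))
                  + t * (y$4 - ((y$2)^2 + (y$3)^2) / (2 * y$1))"
    using x y st by (intro add_mono mult_left_mono) (auto simp: G2_def)
  moreover have "s * \<epsilon> + t * \<epsilon> = \<epsilon>" using st by (metis distrib_right mult_1)
  ultimately show "s *\<^sub>R x + t *\<^sub>R y \<in> G2 \<epsilon>"
    using q[of "x$2" "y$2"] q[of "x$3" "y$3"]
    by (simp add: G2_def add_divide_distrib right_diff_distrib distrib_left)
qed

lemma convex_G3: assumes "\<epsilon> > 0" shows "convex (G3 \<epsilon>)"
proof (rule convexI)
  fix x y :: "real ^ 5" and s t :: real
  assume x: "x \<in> G3 \<epsilon>" and y: "y \<in> G3 \<epsilon>" and st: "0 \<le> s" "0 \<le> t" "s + t = 1"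
  have px: "x$1 > 0" and py: "y$1 > 0" using x y assms by (auto simp: G3_def)
  note q = quad_over_lin[OF px py st]
  have "s * \<epsilon> + t * \<epsilon> \<le> s * x$1 + t * y$1"
    using x y st by (intro add_mono mult_left_mono) (auto simp: G3_def)
  moreover have "s * \<epsilon> + t * \<epsilon> \<le> s * (x$5 - ((x$2)^2 + (x$3)^2 + (x$4)^2) / (2 * x$1))
                  + t * (y$5 - ((y$2)^2 + (y$3)^2 + (y$4)^2) / (2 * y$1))"
    using x y st by (intro add_mono mult_left_mono) (auto simp: G3_def)
  moreover have "s * \<epsilon> + t * \<epsilon> = \<epsilon>" using st by (metis distrib_right mult_1)
  ultimately show "s *\<^sub>R x + t *\<^sub>R y \<in> G3 \<epsilon>"
    using q[of "x$2" "y$2"] q[of "x$3" "y$3"] q[of "x$4" "y$4"]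
    by (simp add: G3_def add_divide_distrib right_diff_distrib distrib_left)
qed

lemma closed_G2: assumes "\<epsilon> > 0" shows "closed (G2 \<epsilon>)"
proof -
  have "G2 \<epsilon> = {x. \<epsilon> \<le> x$1} \<inter> {x. (x$2)^2 + (x$3)^2 \<le> (x$4 - \<epsilon>) * (2 * x$1)}"
    using assms by (fastforce simp: G2_def field_simps)
  then show ?thesis
    by (auto intro!: closed_Int closed_Collect_le continuous_intros)
qed

lemma closed_G3: assumes "\<epsilon> > 0" shows "closed (G3 \<epsilon>)"
proof -
  have "G3 \<epsilon> = {x. \<epsilon> \<le> x$1} \<inter> {x. (x$2)^2 + (x$3)^2 + (x$4)^2 \<le> (x$5 - \<epsilon>) * (2 * x$1)}"
    using assms by (fastforce simp: G3_def field_simps)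
  then show ?thesis
    by (auto intro!: closed_Int closed_Collect_le continuous_intros)
qed

lemma vector_4_nth [simp]:
  "(vector [a, b, c, d] :: ('a::zero) ^ 4)$1 = a"
  "(vector [a, b, c, d] :: 'a ^ 4)$2 = b"
  "(vector [a, b, c, d] :: 'a ^ 4)$3 = c"
  "(vector [a, b, c, d] :: 'a ^ 4)$4 = d"
  by (simp_all add: vector_def)

lemma vector_5_nth [simp]:
  "(vector [a, b, c, d, e] :: ('a::zero) ^ 5)$1 = a"
  "(vector [a, b, c, d, e] :: 'a ^ 5)$2 = b"
  "(vector [a, b, c, d, e] :: 'a ^ 5)$3 = c"
  "(vector [a, b, c, d, e] :: 'a ^ 5)$4 = d"
  "(vector [a, b, c, d, e] :: 'a ^ 5)$5 = e"
  by (simp_all add: vector_def)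

lemma G2_nonempty: "G2 \<epsilon> \<noteq> {}"
proof -
  have "vector [\<epsilon>, 0, 0, \<epsilon>] \<in> G2 \<epsilon>" by (simp add: G2_def)
  then show ?thesis by blast
qed

lemma G3_nonempty: "G3 \<epsilon> \<noteq> {}"
proof -
  have "vector [\<epsilon>, 0, 0, 0, \<epsilon>] \<in> G3 \<epsilon>" by (simp add: G3_def)
  then show ?thesis by blast
qed

lemma closest_point_G2_iff:
  assumes "\<epsilon> > 0"
  shows "closest_point (G2 \<epsilon>) x = p \<longleftrightarrow> p \<in> G2 \<epsilon> \<and> (\<forall>q\<in>G2 \<epsilon>. dist x p \<le> dist x q)"
  using closest_point_exists[OF closed_G2[OF assms] G2_nonempty, of x]
    closest_point_unique[OF convex_G2[OF assms] closed_G2[OF assms], of p x] by auto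

lemma closest_point_G3_iff:
  assumes "\<epsilon> > 0"
  shows "closest_point (G3 \<epsilon>) x = p \<longleftrightarrow> p \<in> G3 \<epsilon> \<and> (\<forall>q\<in>G3 \<epsilon>. dist x p \<le> dist x q)"
  using closest_point_exists[OF closed_G3[OF assms] G3_nonempty, of x]
    closest_point_unique[OF convex_G3[OF assms] closed_G3[OF assms], of p x] by auto

end

theory Submission
  imports Defs
begin

text \<open>
  The candidates are necessary forms of a solution of the Karush-Kuhn-Tucker (KKT) conditions for
  the projection of
  \<open>x = [u, v\<^sub>1, v\<^sub>2, v\<^sub>3, w]\<close>. Since \<open>G3 \<epsilon>\<close> is convex, its nearest point \<open>p = [\<rho>, m, E]\<close> makes
  \<open>(x - p) \<bullet> (y - p) \<le> 0\<close> for every \<open>y \<in> G3 \<epsilon>\<close>. Moving \<open>y\<close> along suitable curves in \<open>G3 \<epsilon>\<close>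
  turns this into \<open>\<lambda> = E - w \<ge> 0\<close>, the vanishing of \<open>\<lambda>\<close> unless the energy constraint is active,
  \<open>m (\<rho> + \<lambda>) = \<rho> v\<close>, and a multiplier
  \<open>\<mu> = \<rho> - u - \<lambda> \<bar>m\<bar>\<^sup>2 / (2 \<rho>\<^sup>2) \<ge> 0\<close> that vanishes unless \<open>\<rho> = \<epsilon>\<close>
  (\<open>projection_G3_optimality\<close>).

  The four sign patterns of \<open>(\<lambda>, \<mu>)\<close> give the candidates (\<open>projection_in_candidates\<close>). Both zero
  means \<open>p = x\<close>, which is excluded because \<open>x \<notin> G3 \<epsilon>\<close>; \<open>\<lambda> = 0 < \<mu>\<close> is candidate 1; both positive is
  candidate 2 or 3; \<open>\<mu> = 0 < \<lambda>\<close> is candidate 4 or 5, according to whether \<open>v = 0\<close>. In cases 3 and 5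
  the momentum is parallel to \<open>v\<close>, so that everything is expressed through \<open>m\<^sub>3\<close>. The only
  computation with content is the elimination of \<open>m\<^sub>3\<close> and \<open>\<lambda>\<close> in case 5, which leaves a
  quadratic equation for \<open>\<rho>\<close> (\<open>rho_quadratic\<close>).

  Conversely every candidate lies in \<open>G3 \<epsilon>\<close> (\<open>candidates_subset_G3\<close>), whether or not it is the
  projection. The projection is therefore a point of the candidate set that is nearest even in the
  larger set \<open>G3 \<epsilon>\<close>; the minimum over the candidates is attained there, and only there because
  nearest points of a closed convex set are unique.

  When \<open>v\<^sub>3 = 0\<close>, deleting the third momentum component maps \<open>G3 \<epsilon>\<close> into \<open>G2 \<epsilon>\<close> without increasing
  the distance to the given point, so the problem reduces to \<open>d = 2\<close>.
\<close>

section \<open>Coordinates in dimensions four and five\<close>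

lemma UNIV_5: "(UNIV :: 5 set) = {1, 2, 3, 4, 5}"
proof -
  have "x = 1 \<or> x = 2 \<or> x = 3 \<or> x = 4 \<or> x = 5" for x :: 5
  proof (induct x)
    case (of_int z)
    then have "0 \<le> z" and "z < 5" by simp_all
    then have "z = 0 \<or> z = 1 \<or> z = 2 \<or> z = 3 \<or> z = 4" by arith
    then show ?case by auto
  qed
  then show ?thesis by auto
qed

lemma sum_5: "sum f (UNIV :: 5 set) = f 1 + f 2 + f 3 + f 4 + f 5"
  for f :: "5 \<Rightarrow> 'a::comm_monoid_add"
  unfolding UNIV_5 by (simp add: ac_simps)

lemma vec5_eq_iff:
  "x = y \<longleftrightarrow> x$1 = y$1 \<and> x$2 = y$2 \<and> x$3 = y$3 \<and> x$4 = y$4 \<and> x$5 = y$5"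
  for x y :: "'a ^ 5"
proof -
  have "(\<forall>i::5. P i) \<longleftrightarrow> P 1 \<and> P 2 \<and> P 3 \<and> P 4 \<and> P 5" for P
    by (metis UNIV_5 UNIV_I empty_iff insert_iff)
  then show ?thesis by (simp only: vec_eq_iff)
qed

lemma dist_vec4_squared:
  "(dist x y)\<^sup>2 = (x$1 - y$1)\<^sup>2 + (x$2 - y$2)\<^sup>2 + (x$3 - y$3)\<^sup>2 + (x$4 - y$4)\<^sup>2"
  for x y :: "real ^ 4"
  unfolding dist_norm power2_norm_eq_inner
  by (simp add: inner_vec_def sum_4 flip: power2_eq_square)

lemma dist_vec5_squared:
  "(dist x y)\<^sup>2 = (x$1 - y$1)\<^sup>2 + (x$2 - y$2)\<^sup>2 + (x$3 - y$3)\<^sup>2 + (x$4 - y$4)\<^sup>2 + (x$5 - y$5)\<^sup>2"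
  for x y :: "real ^ 5"
  unfolding dist_norm power2_norm_eq_inner
  by (simp add: inner_vec_def sum_5 flip: power2_eq_square)

lemma dist_le_iff_squared: "dist x y \<le> dist a b \<longleftrightarrow> (dist x y)\<^sup>2 \<le> (dist a b)\<^sup>2"
  by simp

lemma objective_eq_dist:
  "objective u v1 v2 v3 w p = (dist (vector [u, v1, v2, v3, w]) p)\<^sup>2 / 2"
  by (simp add: objective_def dist_vec5_squared power2_commute)

section \<open>Optimality conditions for the projection\<close>

text \<open>
  First-order conditions without calculus: along each curve used below, the variational inequality
  can be brought into the form \<open>h (c + b h) \<le> 0\<close>, and \<open>c\<close> is the directional derivative at
  \<open>h = 0\<close>. The bound \<open>\<eta>\<close> on the step accounts for the constraint \<open>\<rho> \<ge> \<epsilon>\<close>.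
\<close>

lemma nonpos_of_affine_nonpos:
  fixes b c \<eta> :: real
  assumes "\<eta> > 0" and neg: "\<And>h. 0 < h \<Longrightarrow> h \<le> \<eta> \<Longrightarrow> h * (c + b * h) \<le> 0"
  shows "c \<le> 0"
proof (rule ccontr)
  assume "\<not> c \<le> 0"
  \<comment> \<open>A step so short that \<open>\<bar>b h\<bar> < c\<close>; the summand 1 covers \<open>b = 0\<close>.\<close>
  define h where "h = min \<eta> (c / (2 * (\<bar>b\<bar> + 1)))"
  have h: "0 < h" "h \<le> \<eta>" "h \<le> c / (2 * (\<bar>b\<bar> + 1))"
    using \<open>\<not> c \<le> 0\<close> \<open>\<eta> > 0\<close> by (auto simp: h_def)
  have "h * (2 * (\<bar>b\<bar> + 1)) \<le> c"
    using h(3) by (simp add: pos_le_divide_eq)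
  moreover have "\<bar>b * h\<bar> = \<bar>b\<bar> * h" using h(1) by (simp add: abs_mult)
  ultimately have "c + b * h > 0"
    using h(1) \<open>\<not> c \<le> 0\<close> by (simp add: algebra_simps abs_if split: if_splits)
  then show False using neg[OF h(1,2)] h(1) by (simp add: mult_le_0_iff)
qed

lemma stationary_of_quadratic_nonpos:
  fixes b c :: real
  assumes neg: "\<And>h. h * (c + b * h) \<le> 0"
  shows "c = 0"
proof -
  have "c \<le> 0" using nonpos_of_affine_nonpos[of 1 c b] neg by simp
  moreover have "- c \<le> 0"
  proof (rule nonpos_of_affine_nonpos[of 1])
    show "h * (- c + b * h) \<le> 0" for h using neg[of "- h"] by (simp add: algebra_simps)
  qed simp
  ultimately show ?thesis by simp
qed

text \<open>
  The test point has density \<open>r\<close>, momentum \<open>n\<close> and the energy of \<open>p\<close> corrected by the change of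
  kinetic energy. Its internal energy equals that of \<open>p\<close>, so it lies in \<open>G3 \<epsilon>\<close> whether or not the
  energy constraint is active at \<open>p\<close>. This lets density and momentum vary freely and spares a case
  distinction on the active constraints.
\<close>

lemma projection_G3_variational:
  fixes x :: "real ^ 5" and r n1 n2 n3 :: real
  assumes "\<epsilon> > 0" and p: "p = closest_point (G3 \<epsilon>) x" and "r \<ge> \<epsilon>"
  shows "(x$1 - p$1) * (r - p$1) + (x$2 - p$2) * (n1 - p$2) + (x$3 - p$3) * (n2 - p$3)
      + (x$4 - p$4) * (n3 - p$4)
      - (p$5 - x$5) * ((n1\<^sup>2 + n2\<^sup>2 + n3\<^sup>2) / (2 * r)
                       - ((p$2)\<^sup>2 + (p$3)\<^sup>2 + (p$4)\<^sup>2) / (2 * p$1)) \<le> 0"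
proof -
  define D where "D = (n1\<^sup>2 + n2\<^sup>2 + n3\<^sup>2) / (2 * r)
    - ((p$2)\<^sup>2 + (p$3)\<^sup>2 + (p$4)\<^sup>2) / (2 * p$1)"
  define y :: "real ^ 5" where "y = vector [r, n1, n2, n3, p$5 + D]"
  have "p \<in> G3 \<epsilon>"
    unfolding p by (rule closest_point_in_set[OF closed_G3[OF \<open>\<epsilon> > 0\<close>] G3_nonempty])
  then have "y \<in> G3 \<epsilon>" using \<open>r \<ge> \<epsilon>\<close> by (simp add: G3_def y_def D_def)
  from closest_point_dot[OF convex_G3[OF \<open>\<epsilon> > 0\<close>] closed_G3[OF \<open>\<epsilon> > 0\<close>] this]
  have "(x - p) \<bullet> (y - p) \<le> 0" unfolding p .
  then show ?thesis
    unfolding D_def[symmetric] by (simp add: inner_vec_def sum_5 y_def left_diff_distrib)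
qed

text \<open>
  The KKT conditions, where \<open>lam\<close> is the multiplier of the energy constraint and \<open>mu\<close> that of
  \<open>\<rho> \<ge> \<epsilon>\<close>. The two complementarity products come from one-sided variations: of the energy down to
  the boundary, and of the density down to \<open>\<epsilon>\<close>.
\<close>

lemma projection_G3_optimality:
  fixes x :: "real ^ 5"
  assumes "\<epsilon> > 0" and p: "p = closest_point (G3 \<epsilon>) x"
  defines "S \<equiv> (p$2)\<^sup>2 + (p$3)\<^sup>2 + (p$4)\<^sup>2"
    and "lam \<equiv> p$5 - x$5"
  defines "mu \<equiv> p$1 - x$1 - lam * S / (2 * (p$1)\<^sup>2)"
  shows "lam \<ge> 0" and "mu \<ge> 0"
    and "lam * (p$5 - S / (2 * p$1) - \<epsilon>) = 0" and "mu * (p$1 - \<epsilon>) = 0"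
    and "p$2 * (p$1 + lam) = p$1 * x$2"
    and "p$3 * (p$1 + lam) = p$1 * x$3"
    and "p$4 * (p$1 + lam) = p$1 * x$4"
proof -
  have pG: "p \<in> G3 \<epsilon>"
    unfolding p by (rule closest_point_in_set[OF closed_G3[OF \<open>\<epsilon> > 0\<close>] G3_nonempty])
  then have ge: "p$1 \<ge> \<epsilon>" and pos: "p$1 > 0" and slack: "p$5 - S / (2 * p$1) - \<epsilon> \<ge> 0"
    using \<open>\<epsilon> > 0\<close> by (auto simp: G3_def S_def)
  have dot: "(x - p) \<bullet> (y - p) \<le> 0" if "y \<in> G3 \<epsilon>" for y
    using closest_point_dot[OF convex_G3[OF \<open>\<epsilon> > 0\<close>] closed_G3[OF \<open>\<epsilon> > 0\<close>] that, of x]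
    unfolding p .
  have vertical: "lam * (E - p$5) \<ge> 0" if "E - S / (2 * p$1) \<ge> \<epsilon>" for E
  proof -
    have "vector [p$1, p$2, p$3, p$4, E] \<in> G3 \<epsilon>"
      using that ge by (simp add: G3_def S_def)
    from dot[OF this] show ?thesis
      by (simp add: inner_vec_def sum_5 lam_def algebra_simps)
  qed
  show lam: "lam \<ge> 0" using vertical[of "p$5 + 1"] slack by simp
  have "lam * (p$5 - S / (2 * p$1) - \<epsilon>) \<le> 0"
    using vertical[of "S / (2 * p$1) + \<epsilon>"] by (simp add: algebra_simps)
  with lam slack show "lam * (p$5 - S / (2 * p$1) - \<epsilon>) = 0"
    by (metis antisym mult_nonneg_nonneg)

  note var = projection_G3_variational[OF \<open>\<epsilon> > 0\<close> p, folded S_def lam_def]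
  have momentum: "m * (p$1 + lam) = p$1 * v"
    if "\<And>h. (v - m) * h - lam * (((m + h)\<^sup>2 - m\<^sup>2) / (2 * p$1)) \<le> 0" for m v
  proof -
    have "h * ((v - m - lam * m / p$1) + (- lam / (2 * p$1)) * h) \<le> 0" for h
    proof -
      have "h * ((v - m - lam * m / p$1) + (- lam / (2 * p$1)) * h)
          = (v - m) * h - lam * (((m + h)\<^sup>2 - m\<^sup>2) / (2 * p$1))"
        using pos by (simp add: field_simps power2_eq_square)
      with that[of h] show ?thesis by simp
    qed
    from stationary_of_quadratic_nonpos[OF this] show ?thesis
      using pos by (simp add: field_simps)
  qed
  show "p$2 * (p$1 + lam) = p$1 * x$2"
  proof (rule momentum)
    fix h
    show "(x$2 - p$2) * h - lam * (((p$2 + h)\<^sup>2 - (p$2)\<^sup>2) / (2 * p$1)) \<le> 0"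
      using var[OF ge, of "p$2 + h" "p$3" "p$4"]
      by (simp add: S_def flip: diff_divide_distrib)
  qed
  show "p$3 * (p$1 + lam) = p$1 * x$3"
  proof (rule momentum)
    fix h
    show "(x$3 - p$3) * h - lam * (((p$3 + h)\<^sup>2 - (p$3)\<^sup>2) / (2 * p$1)) \<le> 0"
      using var[OF ge, of "p$2" "p$3 + h" "p$4"]
      by (simp add: S_def flip: diff_divide_distrib)
  qed
  show "p$4 * (p$1 + lam) = p$1 * x$4"
  proof (rule momentum)
    fix h
    show "(x$4 - p$4) * h - lam * (((p$4 + h)\<^sup>2 - (p$4)\<^sup>2) / (2 * p$1)) \<le> 0"
      using var[OF ge, of "p$2" "p$3" "p$4 + h"]
      by (simp add: S_def flip: diff_divide_distrib)
  qed

  \<comment> \<open>Multiplying by \<open>(\<rho> + h) / \<rho>\<close> clears the denominator \<open>\<rho> + h\<close> and makes the second factor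
    affine in \<open>h\<close>, with value \<open>- mu\<close> at \<open>h = 0\<close>.\<close>
  have density: "h * (- mu + (x$1 - p$1) / p$1 * h) \<le> 0" if "p$1 + h \<ge> \<epsilon>" for h
  proof -
    have pos': "p$1 + h > 0" using that \<open>\<epsilon> > 0\<close> by linarith
    have "(x$1 - p$1) * h - lam * (S / (2 * (p$1 + h)) - S / (2 * p$1)) \<le> 0"
      using var[OF that, of "p$2" "p$3" "p$4"] by (simp flip: S_def)
    then have "((p$1 + h) / p$1)
        * ((x$1 - p$1) * h - lam * (S / (2 * (p$1 + h)) - S / (2 * p$1))) \<le> 0"
      using pos pos' by (intro mult_nonneg_nonpos) auto
    also have "((p$1 + h) / p$1)
        * ((x$1 - p$1) * h - lam * (S / (2 * (p$1 + h)) - S / (2 * p$1)))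
      = h * (- mu + (x$1 - p$1) / p$1 * h)"
      using pos pos' unfolding mu_def by (simp add: divide_simps power2_eq_square) algebra
    finally show ?thesis .
  qed
  have "- mu \<le> 0"
    by (rule nonpos_of_affine_nonpos[of 1 _ "(x$1 - p$1) / p$1"]) (use density ge in simp_all)
  then show mu: "mu \<ge> 0" by simp
  show "mu * (p$1 - \<epsilon>) = 0"
  proof (cases "p$1 = \<epsilon>")
    case False
    have "mu \<le> 0"
    proof (rule nonpos_of_affine_nonpos[of "p$1 - \<epsilon>"])
      show "p$1 - \<epsilon> > 0" using False ge by simp
      fix h assume "0 < h" "h \<le> p$1 - \<epsilon>"
      then show "h * (mu + (x$1 - p$1) / p$1 * h) \<le> 0"
        using density[of "- h"] by (simp add: algebra_simps)
    qed
    with mu show ?thesis by simp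
  qed simp
qed

section \<open>The candidates\<close>

lemma coeff_a_pos: "coeff_a v1 v2 v3 > 0"
  unfolding coeff_a_def by (smt (verit) divide_nonneg_nonneg zero_le_power2)

lemma sum_squares_parallel:
  assumes "v3 \<noteq> 0"
  shows "(v1 / v3 * m)\<^sup>2 + (v2 / v3 * m)\<^sup>2 + m\<^sup>2 = coeff_a v1 v2 v3 * m\<^sup>2"
  using assms by (simp add: coeff_a_def field_simps)

text \<open>
  Candidates 2 to 5 have internal energy exactly \<open>\<epsilon>\<close>; for candidate 1 the defining inequality is the
  energy constraint itself.
\<close>

lemma candidates_subset_G3:
  assumes "\<epsilon> > 0"
  shows "candidates \<epsilon> u v1 v2 v3 w \<subseteq> G3 \<epsilon>"
proof -
  have "cand1 \<epsilon> u v1 v2 v3 w \<subseteq> G3 \<epsilon>" "cand2 \<epsilon> u v1 v2 v3 w \<subseteq> G3 \<epsilon>"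
    "cand4 \<epsilon> u v1 v2 v3 w \<subseteq> G3 \<epsilon>"
    by (auto simp: cand1_def cand2_def cand4_def G3_def)
  moreover have "cand3 \<epsilon> u v1 v2 v3 w \<subseteq> G3 \<epsilon>" "cand5 \<epsilon> u v1 v2 v3 w \<subseteq> G3 \<epsilon>"
    by (auto simp: cand3_def cand5_def G3_def Let_def sum_squares_parallel[simplified])
  ultimately show ?thesis unfolding candidates_def by blast
qed

text \<open>
  Here \<open>t = \<lambda> / \<rho>\<close>, \<open>k = \<epsilon> - w\<close> and \<open>V = v\<^sub>3\<close>; \<open>stat\<close> says \<open>\<mu> = 0\<close> and \<open>active\<close> says that the energy
  constraint is an equality. Eliminating \<open>m\<close>, respectively \<open>\<rho>\<^sup>2\<close>, between the two gives
  \<open>k t - u = \<rho> (t\<^sup>2 - 1)\<close> and \<open>2 \<rho> (k - u t) = a m\<^sup>2 (t\<^sup>2 - 1)\<close>, so in the product of both the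
  density cancels: \<open>2 (k - u t) (k t - u) = a m\<^sup>2 (t\<^sup>2 - 1)\<^sup>2\<close>. By the identity
  \<open>(k - u t) (k t - u) = t (k + u)\<^sup>2 - u k (1 + t)\<^sup>2\<close>, together with \<open>V = m (1 + t)\<close> and \<open>stat\<close>, this
  relation becomes linear in \<open>\<rho> (\<rho> - u)\<close>, which is the quadratic equation claimed.
\<close>

lemma rho_quadratic:
  fixes a u k \<rho> t V m :: real
  assumes "a > 0" and "\<rho> > 0" and m: "m * (1 + t) = V"
    and stat: "\<rho> - u = a * m\<^sup>2 * t / (2 * \<rho>)"
    and active: "k + a * m\<^sup>2 / (2 * \<rho>) = \<rho> * t"
  shows "(2 * \<rho> - u)\<^sup>2 * (2 * V\<^sup>2 + 1 / a * (k + u)\<^sup>2)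
    = u\<^sup>2 * (2 * V\<^sup>2 + 1 / a * (k + u)\<^sup>2) + 2 * u * V\<^sup>2 * k + a * V ^ 4"
proof -
  have stat': "2 * \<rho> * (\<rho> - u) = a * m\<^sup>2 * t"
    using stat \<open>\<rho> > 0\<close> by (simp add: field_simps)
  have active': "2 * \<rho> * k + a * m\<^sup>2 = 2 * \<rho>\<^sup>2 * t"
    using active \<open>\<rho> > 0\<close> by (simp add: field_simps power2_eq_square)
  have e1: "2 * \<rho> * (k - u * t) = a * m\<^sup>2 * (t\<^sup>2 - 1)"
    using stat' active' by algebra
  have "\<rho> * (k * t - u) = \<rho> * (\<rho> * (t\<^sup>2 - 1))"
    using stat' active' by algebra
  then have e2: "k * t - u = \<rho> * (t\<^sup>2 - 1)" using \<open>\<rho> > 0\<close> by simp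
  have "\<rho> * (2 * ((k - u * t) * (k * t - u))) = \<rho> * (a * m\<^sup>2 * (t\<^sup>2 - 1)\<^sup>2)"
    using e1 e2 by algebra
  then have e3: "2 * ((k - u * t) * (k * t - u)) = a * m\<^sup>2 * (t\<^sup>2 - 1)\<^sup>2"
    using \<open>\<rho> > 0\<close> by simp
  have "4 * \<rho> * (\<rho> - u) * (2 * a * V\<^sup>2 + (k + u)\<^sup>2) = a * (2 * u * V\<^sup>2 * k + a * V ^ 4)"
    using stat' e3 unfolding m[symmetric] by algebra
  then have "a * (4 * \<rho> * (\<rho> - u) * (2 * V\<^sup>2 + 1 / a * (k + u)\<^sup>2))
      = a * (2 * u * V\<^sup>2 * k + a * V ^ 4)"
    using \<open>a > 0\<close> by (simp add: field_simps)
  then have "4 * \<rho> * (\<rho> - u) * (2 * V\<^sup>2 + 1 / a * (k + u)\<^sup>2) = 2 * u * V\<^sup>2 * k + a * V ^ 4"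
    using \<open>a > 0\<close> by simp
  then show ?thesis by algebra
qed

text \<open>
  The discriminant equals \<open>(2 \<rho> - u)\<^sup>2\<close> times a positive number, so it is nonnegative and the value
  is real automatically; the sign of \<open>2 \<rho> - u\<close> selects the root. The next lemma works the same way
  with \<open>(a (2 m - v\<^sub>3))\<^sup>2\<close>.
\<close>

lemma rho_values_I:
  assumes "v3 \<noteq> 0" and eq: "(2 * \<rho> - u)\<^sup>2 * (2 * v3\<^sup>2 + 1 / coeff_a v1 v2 v3 * (\<epsilon> - w + u)\<^sup>2)
    = u\<^sup>2 * (2 * v3\<^sup>2 + 1 / coeff_a v1 v2 v3 * (\<epsilon> - w + u)\<^sup>2) + 2 * u * v3\<^sup>2 * (\<epsilon> - w)
      + coeff_a v1 v2 v3 * v3 ^ 4"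
  shows "\<rho> \<in> rho_values \<epsilon> u v1 v2 v3 w"
proof -
  define d where "d = 2 * v3\<^sup>2 + 1 / coeff_a v1 v2 v3 * (\<epsilon> + u - w)\<^sup>2"
  define n where "n = u\<^sup>2 * d - 2 * u * v3\<^sup>2 * (w - \<epsilon>) + coeff_a v1 v2 v3 * v3 ^ 4"
  have "d > 0" unfolding d_def using \<open>v3 \<noteq> 0\<close> coeff_a_pos[of v1 v2 v3]
    by (intro add_pos_nonneg) auto
  have "\<epsilon> - w + u = \<epsilon> + u - w" by simp
  then have n: "n = (2 * \<rho> - u)\<^sup>2 * d"
    using eq unfolding n_def d_def by (simp add: algebra_simps)
  then have "n \<ge> 0" using \<open>d > 0\<close> by simp
  moreover have "sqrt n / sqrt d = \<bar>2 * \<rho> - u\<bar>"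
    using \<open>d > 0\<close> by (simp add: n real_sqrt_mult)
  then have "\<rho> = u / 2 + 1 / 2 * (sqrt n / sqrt d) \<or> \<rho> = u / 2 - 1 / 2 * (sqrt n / sqrt d)"
    by (auto simp: abs_if field_simps)
  ultimately show ?thesis
    unfolding rho_values_def Let_def n_def d_def by blast
qed

lemma m3_values_I:
  assumes eq: "2 * \<rho> * (\<rho> - u) = coeff_a v1 v2 v3 * m * (v3 - m)"
  shows "m \<in> m3_values u v1 v2 v3 \<rho>"
proof -
  define a where "a = coeff_a v1 v2 v3"
  have "a > 0" unfolding a_def by (rule coeff_a_pos)
  define d where "d = - 8 * a * \<rho>\<^sup>2 + 8 * a * u * \<rho> + a\<^sup>2 * v3\<^sup>2"
  have d: "d = (a * (2 * m - v3))\<^sup>2"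
    using eq unfolding d_def a_def[symmetric] by algebra
  then have "d \<ge> 0" by simp
  moreover have "1 / (2 * a) * sqrt d = \<bar>2 * m - v3\<bar> / 2"
    using \<open>a > 0\<close> by (simp add: d abs_mult)
  then have "m = v3 / 2 + 1 / (2 * a) * sqrt d \<or> m = v3 / 2 - 1 / (2 * a) * sqrt d"
    by (auto simp: abs_if field_simps)
  ultimately show ?thesis
    unfolding m3_values_def Let_def d_def a_def by blast
qed

lemma projection_in_candidates:
  assumes "\<epsilon> > 0" and out: "vector [u, v1, v2, v3, w] \<notin> G3 \<epsilon>"
    and v: "v3 \<noteq> 0 \<or> (v1 = 0 \<and> v2 = 0 \<and> v3 = 0)"
  shows "closest_point (G3 \<epsilon>) (vector [u, v1, v2, v3, w]) \<in> candidates \<epsilon> u v1 v2 v3 w"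
proof -
  define p where "p = closest_point (G3 \<epsilon>) (vector [u, v1, v2, v3, w])"
  define \<rho> m1 m2 m3 E where coords: "\<rho> = p$1" "m1 = p$2" "m2 = p$3" "m3 = p$4" "E = p$5"
  define S where "S = m1\<^sup>2 + m2\<^sup>2 + m3\<^sup>2"
  define lam where "lam = E - w"
  define mu where "mu = \<rho> - u - lam * S / (2 * \<rho>\<^sup>2)"
  have pG: "p \<in> G3 \<epsilon>"
    unfolding p_def by (rule closest_point_in_set[OF closed_G3[OF \<open>\<epsilon> > 0\<close>] G3_nonempty])
  have p: "p = vector [\<rho>, m1, m2, m3, E]" by (simp add: vec5_eq_iff coords)
  note kkt = projection_G3_optimality[OF \<open>\<epsilon> > 0\<close> p_def, unfolded vector_5_nth, folded coords,
      folded S_def lam_def, folded mu_def]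
  have ge: "\<rho> \<ge> \<epsilon>" and feas: "E - S / (2 * \<rho>) \<ge> \<epsilon>"
    using pG by (auto simp: G3_def S_def coords)
  have pos: "\<rho> > 0" using ge \<open>\<epsilon> > 0\<close> by simp
  show ?thesis
  proof (cases "lam = 0")
    case True
    then have m: "m1 = v1" "m2 = v2" "m3 = v3" and E: "E = w"
      using kkt pos by (auto simp: lam_def)
    have "mu \<noteq> 0"
    proof
      assume "mu = 0"
      then have "\<rho> = u" using True by (simp add: mu_def)
      then show False using out pG by (simp add: p m E)
    qed
    then have "\<rho> = \<epsilon>" and "mu > 0" using kkt(2,4) by auto
    then have "\<epsilon> > u" using True by (simp add: mu_def)
    moreover have "\<epsilon> - w + (v1\<^sup>2 + v2\<^sup>2 + v3\<^sup>2) / (2 * \<epsilon>) \<le> 0"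
      using feas by (simp add: S_def m E \<open>\<rho> = \<epsilon>\<close>)
    ultimately have "p \<in> cand1 \<epsilon> u v1 v2 v3 w"
      by (simp add: cand1_def p m E \<open>\<rho> = \<epsilon>\<close>)
    then show ?thesis by (simp add: candidates_def p_def)
  next
    case False
    then have lam: "lam > 0" using kkt(1) by simp
    then have E: "E = \<epsilon> + S / (2 * \<rho>)" using kkt(3) by simp
    show ?thesis
    proof (cases "v3 = 0")
      case True
      then have v0: "v1 = 0" "v2 = 0" "v3 = 0" using v by auto
      then have m: "m1 = 0" "m2 = 0" "m3 = 0" using kkt(5-7) lam pos by auto
      then have S: "S = 0" and E': "E = \<epsilon>" by (simp_all add: E S_def)
      have w: "\<epsilon> > w" using lam by (simp add: lam_def E')
      have mu: "mu = \<rho> - u" by (simp add: mu_def S)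
      show ?thesis
      proof (cases "mu = 0")
        case True
        then have "p \<in> cand4 \<epsilon> u v1 v2 v3 w"
          using ge w by (simp add: cand4_def p m E' v0 mu)
        then show ?thesis by (simp add: candidates_def p_def)
      next
        case False
        then have "\<rho> = \<epsilon>" using kkt(4) by simp
        moreover have "\<epsilon> > u" using False kkt(2) by (simp add: mu \<open>\<rho> = \<epsilon>\<close>)
        ultimately have "p \<in> cand2 \<epsilon> u v1 v2 v3 w"
          using w by (simp add: cand2_def p m E' v0)
        then show ?thesis by (simp add: candidates_def p_def)
      qed
    next
      case v3: False
      define a where "a = coeff_a v1 v2 v3"
      have "a > 0" unfolding a_def by (rule coeff_a_pos)
      have "m3 \<noteq> 0" using kkt(7) pos v3 by auto
      \<comment> \<open>Each momentum component is the corresponding component of \<open>v\<close> times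
        \<open>\<rho> / (\<rho> + lam)\<close>, a factor that the third component expresses as \<open>m3 / v3\<close>.\<close>
      have m_eq: "m = v / v3 * m3" if "m * (\<rho> + lam) = \<rho> * v" for m v
      proof -
        have "(\<rho> + lam) * (m * v3) = (\<rho> + lam) * (v * m3)"
          using that kkt(7) by algebra
        moreover have "\<rho> + lam \<noteq> 0" using pos lam by simp
        ultimately have "m * v3 = v * m3" by simp
        then show ?thesis using v3 by (simp add: field_simps)
      qed
      have m1: "m1 = v1 / v3 * m3" and m2: "m2 = v2 / v3 * m3"
        using m_eq kkt(5,6) by blast+
      have S: "S = a * m3\<^sup>2"
        unfolding S_def m1 m2 a_def by (rule sum_squares_parallel[OF v3])
      have lam_eq: "lam * m3 = \<rho> * (v3 - m3)" using kkt(7) by (simp add: algebra_simps)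
      then have lam_div: "lam = \<rho> * (v3 / m3 - 1)" using \<open>m3 \<noteq> 0\<close> by (simp add: field_simps)
      \<comment> \<open>The last term of \<open>mu\<close> with \<open>lam\<close> eliminated, as it appears in candidates 3 and 5.\<close>
      have flux: "lam * S / (2 * \<rho>\<^sup>2) = a * m3 * (v3 - m3) / (2 * \<rho>)"
        using \<open>m3 \<noteq> 0\<close> pos
        by (simp add: S lam_div field_simps power2_eq_square)
      show ?thesis
      proof (cases "mu = 0")
        case True
        have "\<rho> - u = a * m3 * (v3 - m3) / (2 * \<rho>)" using True by (simp add: mu_def flux)
        then have "2 * \<rho> * (\<rho> - u) = a * m3 * (v3 - m3)" using pos by (simp add: field_simps)
        then have "m3 \<in> m3_values u v1 v2 v3 \<rho>" unfolding a_def by (rule m3_values_I)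
        moreover have "\<rho> \<in> rho_values \<epsilon> u v1 v2 v3 w"
        proof (rule rho_values_I[OF v3], fold a_def, rule rho_quadratic[where t = "lam / \<rho>"])
          show "m3 * (1 + lam / \<rho>) = v3" using kkt(7) pos by (simp add: field_simps)
          show "\<rho> - u = a * m3\<^sup>2 * (lam / \<rho>) / (2 * \<rho>)"
            using True by (simp add: mu_def S power2_eq_square mult_ac)
          show "\<epsilon> - w + a * m3\<^sup>2 / (2 * \<rho>) = \<rho> * (lam / \<rho>)"
            using E pos by (simp add: lam_def S)
        qed (use pos lam \<open>a > 0\<close> in auto)
        moreover have "\<epsilon> + a * (m3\<^sup>2 / (2 * \<rho>)) - w > 0"
          using lam by (simp add: lam_def E S)
        moreover have "p = vector [\<rho>, v1 / v3 * m3, v2 / v3 * m3, m3, \<epsilon> + a * (m3\<^sup>2 / (2 * \<rho>))]"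
          using p by (simp add: m1 m2 E S)
        ultimately have "p \<in> cand5 \<epsilon> u v1 v2 v3 w"
          using v3 ge unfolding cand5_def Let_def a_def by blast
        then show ?thesis by (simp add: candidates_def p_def)
      next
        case False
        then have \<rho>: "\<rho> = \<epsilon>" and "mu > 0" using kkt(2,4) by auto
        have "\<epsilon> * (v3 / m3 - 1) > 0" using lam by (simp add: lam_div \<rho>)
        moreover have "\<epsilon> - u - a / (2 * \<epsilon>) * m3 * (v3 - m3) > 0"
          using \<open>mu > 0\<close> flux unfolding mu_def by (simp add: \<rho>)
        moreover have "a * m3 ^ 3 + (4 * \<epsilon>\<^sup>2 - 2 * \<epsilon> * w) * m3 - 2 * \<epsilon>\<^sup>2 * v3 = 0"
        proof -
          have "2 * \<epsilon> * (lam - (\<epsilon> - w)) = a * m3\<^sup>2"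
            using \<open>\<epsilon> > 0\<close> by (simp add: lam_def E S \<rho>)
          then show ?thesis using lam_eq unfolding \<rho> by algebra
        qed
        moreover have "p = vector [\<epsilon>, v1 / v3 * m3, v2 / v3 * m3, m3, a / (2 * \<epsilon>) * m3\<^sup>2 + \<epsilon>]"
          using p by (simp add: m1 m2 E S \<rho> add.commute)
        ultimately have "p \<in> cand3 \<epsilon> u v1 v2 v3 w"
          using v3 unfolding cand3_def Let_def a_def by blast
        then show ?thesis by (simp add: candidates_def p_def)
      qed
    qed
  qed
qed

section \<open>Reduction to two momentum components\<close>

text \<open>
  Deleting the third momentum component only lowers the kinetic energy, so it maps \<open>G3 \<epsilon>\<close> into
  \<open>G2 \<epsilon>\<close>; and it only shortens the distance to a point whose own third component is zero.
\<close>

lemma projection_G3_of_projection_G2: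
  assumes "\<epsilon> > 0"
    and "vector [\<rho>, m1, m2, E] = closest_point (G2 \<epsilon>) (vector [u, v1, v2, w])"
  shows "vector [\<rho>, m1, m2, 0, E] = closest_point (G3 \<epsilon>) (vector [u, v1, v2, 0, w])"
proof -
  have G2: "vector [\<rho>, m1, m2, E] \<in> G2 \<epsilon>"
    and near: "\<And>q. q \<in> G2 \<epsilon> \<Longrightarrow>
      dist (vector [u, v1, v2, w]) (vector [\<rho>, m1, m2, E] :: real ^ 4) \<le> dist (vector [u, v1, v2, w]) q"
    using assms(2) closest_point_G2_iff[OF \<open>\<epsilon> > 0\<close>] by metis+
  have "closest_point (G3 \<epsilon>) (vector [u, v1, v2, 0, w]) = vector [\<rho>, m1, m2, 0, E]"
    unfolding closest_point_G3_iff[OF \<open>\<epsilon> > 0\<close>]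
  proof (intro conjI ballI)
    show "vector [\<rho>, m1, m2, 0, E] \<in> G3 \<epsilon>" using G2 by (simp add: G2_def G3_def)
    fix q :: "real ^ 5" assume q: "q \<in> G3 \<epsilon>"
    define q' :: "real ^ 4" where "q' = vector [q$1, q$2, q$3, q$5]"
    have "((q$2)\<^sup>2 + (q$3)\<^sup>2) / (2 * q$1) \<le> ((q$2)\<^sup>2 + (q$3)\<^sup>2 + (q$4)\<^sup>2) / (2 * q$1)"
      using q \<open>\<epsilon> > 0\<close> by (intro divide_right_mono) (auto simp: G3_def)
    then have "q' \<in> G2 \<epsilon>" using q by (auto simp: G2_def G3_def q'_def)
    from near[OF this] show "dist (vector [u, v1, v2, 0, w]) (vector [\<rho>, m1, m2, 0, E] :: real ^ 5)
        \<le> dist (vector [u, v1, v2, 0, w]) q"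
      unfolding dist_le_iff_squared dist_vec4_squared dist_vec5_squared q'_def
      by (simp add: add_increasing2) (smt (verit) zero_le_power2)
  qed
  then show ?thesis by simp
qed

theorem mainTheorem4:
  fixes \<epsilon> u v1 v2 v3 w :: real
  assumes "\<epsilon> > 0"
    and "vector [u, v1, v2, v3, w] \<notin> G3 \<epsilon>"
  shows
    "(v3 \<noteq> 0 \<or> (v1 = 0 \<and> v2 = 0 \<and> v3 = 0) \<longrightarrow>
        (\<exists>p. is_arg_min (objective u v1 v2 v3 w) (\<lambda>q. q \<in> candidates \<epsilon> u v1 v2 v3 w) p) \<and>
        (\<forall>p. is_arg_min (objective u v1 v2 v3 w) (\<lambda>q. q \<in> candidates \<epsilon> u v1 v2 v3 w) p \<longrightarrow>
             p = closest_point (G3 \<epsilon>) (vector [u, v1, v2, v3, w])))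
     \<and>
     (v3 = 0 \<and> \<not> (v1 = 0 \<and> v2 = 0) \<longrightarrow>
        (\<forall>\<rho> m1 m2 E.
           vector [\<rho>, m1, m2, E] = closest_point (G2 \<epsilon>) (vector [u, v1, v2, w]) \<longrightarrow>
           vector [\<rho>, m1, m2, 0, E] = closest_point (G3 \<epsilon>) (vector [u, v1, v2, 0, w])))"
proof (intro conjI impI allI)
  let ?x = "vector [u, v1, v2, v3, w] :: real ^ 5"
  let ?P = "closest_point (G3 \<epsilon>) ?x"
  let ?C = "candidates \<epsilon> u v1 v2 v3 w"
  assume "v3 \<noteq> 0 \<or> (v1 = 0 \<and> v2 = 0 \<and> v3 = 0)"
  from projection_in_candidates[OF assms this] have P: "?P \<in> ?C" .
  have nearest: "?P \<in> G3 \<epsilon> \<and> (\<forall>q\<in>G3 \<epsilon>. dist ?x ?P \<le> dist ?x q)"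
    using closest_point_G3_iff[OF assms(1)] by blast
  have sub: "?C \<subseteq> G3 \<epsilon>" by (rule candidates_subset_G3[OF assms(1)])
  have obj: "objective u v1 v2 v3 w p \<le> objective u v1 v2 v3 w q \<longleftrightarrow> dist ?x p \<le> dist ?x q" for p q
    by (simp add: objective_eq_dist)
  show "\<exists>p. is_arg_min (objective u v1 v2 v3 w) (\<lambda>q. q \<in> ?C) p"
    using P nearest sub by (auto simp: is_arg_min_linorder obj)
  fix p assume "is_arg_min (objective u v1 v2 v3 w) (\<lambda>q. q \<in> ?C) p"
  then have "p \<in> ?C" and "dist ?x p \<le> dist ?x ?P"
    using P by (auto simp: is_arg_min_linorder obj)
  then have "p \<in> G3 \<epsilon> \<and> (\<forall>q\<in>G3 \<epsilon>. dist ?x p \<le> dist ?x q)"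
    using nearest sub by force
  then show "p = ?P" using closest_point_G3_iff[OF assms(1)] by metis
next
  fix \<rho> m1 m2 E
  assume "vector [\<rho>, m1, m2, E] = closest_point (G2 \<epsilon>) (vector [u, v1, v2, w])"
  then show "vector [\<rho>, m1, m2, 0, E] = closest_point (G3 \<epsilon>) (vector [u, v1, v2, 0, w])"
    by (rule projection_G3_of_projection_G2[OF assms(1)])
qed

end
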